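(* Let $X$ be a (K)-polyhedral normed space with property ($\Delta$). Then $S_X$ is covered by algebraic true faces of $B_X$, i.e. every point of $S_X$ belongs to some algebraic true face of $B_X$. Further, if $X$ is additionally (VI)-polyhedral, then $S_X$ is covered by true faces of $B_X$.
   Context: All normed spaces are real. For a normed space $X$, $B_X$ and $S_X$ denote its closed unit ball and unit sphere, and $X^*$ its topological dual. $\operatorname{ext} C$ is the set of extreme points of a convex set $C$. For $x\in S_X$ let $\mathcal D(x)=\{f\in S_{X^*}: f(x)=1\}$. Property ($\Delta$): for every $x\in S_X$ the set $\operatorname{ext}\mathcal D(x)$ is finite. (K)-polyhedral: the unit ball of every finite-dimensional subspace of $X$ is a polytope (the convex hull of finitely many points). (VI)-polyhedral: every $x\in S_X$ has a neighbourhood $V$ such that for every $y\in V\cap S_X$ the segment $[x,y]$ is contained in $S_X$. True faces: a convex body is a closed convex set with non-empty interior. Let $C$ be a convex body in $X$ and $H$ a supporting hyperplane for $C$, i.e. $H=\{x: f(x)=\alpha\}$ with $0\neq f\in X^*$, $\alpha=\sup_C f$ and $H\cap C\ne\emptyset$. The face $F=C\cap H$ is a true face of $C$ if its interior relative to $H$ is non-empty; it is an algebraic true face of $C$ if its algebraic interior relative to $H$ is non-empty, where $p\in F$ is in the algebraic interior of $F$ relative to $H$ if for every $q\in H$ there is $\delta>0$ with $p+t(q-p)\in F$ for all $|t|\le\delta$. *)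

theory Defs
  imports "HOL-Analysis.Analysis"
begin

text \<open>
  The normed space \<open>X\<close> is the type \<open>'a\<close>, its topological dual is \<open>'a \<Rightarrow>\<^sub>L real\<close>, and
  \<open>B\<^sub>X\<close>, \<open>S\<^sub>X\<close> are \<open>cball 0 1\<close>, \<open>sphere 0 1\<close>. Properties of the space take the type itself
  as argument.
\<close>

definition norming_functionals :: "'a::real_normed_vector \<Rightarrow> ('a \<Rightarrow>\<^sub>L real) set" where
  "norming_functionals x = {f \<in> sphere 0 1. blinfun_apply f x = 1}"

definition property_Delta :: "'a::real_normed_vector itself \<Rightarrow> bool" where
  "property_Delta _ \<longleftrightarrow>
     (\<forall>x\<in>sphere (0::'a) 1. finite {f. f extreme_point_of norming_functionals x})"

definition K_polyhedral :: "'a::real_normed_vector itself \<Rightarrow> bool" where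
  "K_polyhedral _ \<longleftrightarrow>
     (\<forall>Y::'a set. subspace Y \<and> (\<exists>B. finite B \<and> Y = span B) \<longrightarrow> polytope (cball 0 1 \<inter> Y))"

definition VI_polyhedral :: "'a::real_normed_vector itself \<Rightarrow> bool" where
  "VI_polyhedral _ \<longleftrightarrow>
     (\<forall>x\<in>sphere (0::'a) 1. \<exists>V. open V \<and> x \<in> V \<and>
        (\<forall>y \<in> V \<inter> sphere 0 1. closed_segment x y \<subseteq> sphere 0 1))"

definition convex_body :: "'a::real_normed_vector set \<Rightarrow> bool" where
  "convex_body C \<longleftrightarrow> closed C \<and> convex C \<and> interior C \<noteq> {}"

text \<open>
  The supremum of an unbounded set of reals is an unspecified value, so finiteness of the
  supremum has to be required explicitly.
\<close>

definition supporting_hyperplane :: "'a::real_normed_vector set \<Rightarrow> 'a set \<Rightarrow> bool" where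
  "supporting_hyperplane C H \<longleftrightarrow>
     (\<exists>(f::'a \<Rightarrow>\<^sub>L real) \<alpha>. f \<noteq> 0 \<and> H = {x. blinfun_apply f x = \<alpha>} \<and>
        bdd_above (blinfun_apply f ` C) \<and> \<alpha> = (SUP x\<in>C. blinfun_apply f x) \<and> H \<inter> C \<noteq> {})"

definition algebraic_interior_in :: "'a::real_vector set \<Rightarrow> 'a set \<Rightarrow> 'a set" where
  "algebraic_interior_in H F =
     {p \<in> F. \<forall>q\<in>H. \<exists>\<delta>>0. \<forall>t. \<bar>t\<bar> \<le> \<delta> \<longrightarrow> p + t *\<^sub>R (q - p) \<in> F}"

definition true_face :: "'a::real_normed_vector set \<Rightarrow> 'a set \<Rightarrow> bool" where
  "true_face C F \<longleftrightarrow> convex_body C \<and>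
     (\<exists>H. supporting_hyperplane C H \<and> F = C \<inter> H \<and> top_of_set H interior_of F \<noteq> {})"

definition algebraic_true_face :: "'a::real_normed_vector set \<Rightarrow> 'a set \<Rightarrow> bool" where
  "algebraic_true_face C F \<longleftrightarrow> convex_body C \<and>
     (\<exists>H. supporting_hyperplane C H \<and> F = C \<inter> H \<and> algebraic_interior_in H F \<noteq> {})"

end

theory Submission
  imports Defs
begin

text \<open>
  Fix a unit vector \<open>x\<close>, and let \<open>p v\<close> be the one-sided derivative of the norm at \<open>x\<close> in the
  direction \<open>v\<close>. This is a sublinear functional, and the linear functionals that it dominates are
  precisely the norming functionals of \<open>x\<close>. Two facts describe the ball near \<open>x\<close>.

  First, every value \<open>p u\<close> is attained at an extreme norming functional
  (\<open>exists_extreme_norming_functional\<close>). This combines the Hahn--Banach and Krein--Milman theorems;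
  one application of Zorn's lemma to sublinear functionals gives both, without compactness. By
  property (\<open>\<Delta>\<close>), \<open>p\<close> is thus the maximum of a finite set \<open>E\<close> of functionals.

  Second, if \<open>p u \<le> 0\<close>, then \<open>x + t u\<close> lies in the ball for some \<open>t > 0\<close>
  (\<open>K_polyhedral_step\<close>): in the plane spanned by \<open>x\<close> and \<open>u\<close> the ball is a polygon, so that no
  tangential direction at \<open>x\<close> leaves it immediately.

  Together, along each single ray from \<open>x\<close> the ball looks like the finite intersection of the
  half-spaces \<open>g \<le> 1\<close> with \<open>g \<in> E\<close>. There are \<open>f \<in> E\<close> and \<open>v\<close> with \<open>f v = 0\<close> and \<open>g v < 0\<close> for all
  other \<open>g \<in> E\<close> (\<open>peak_functional\<close>). Moving from \<open>x\<close> a little in the direction \<open>v\<close> stays in the face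
  of the ball on which \<open>f\<close> equals 1 and makes all other constraints slack, which leads to a point
  in the algebraic interior of this face.

  The length of the admissible step depends on the ray, so in general nothing better than the
  algebraic interior results. With property (VI), a step of any length along a ray implies that
  the whole part of the ray near \<open>x\<close>, of a length common to all rays, is in the ball
  (\<open>norm_le_1_of_segment_in_sphere\<close>), and the interior becomes topological.
\<close>

section \<open>Sublinear functionals and their directional derivatives\<close>

definition sublinear :: "('a::real_vector \<Rightarrow> real) \<Rightarrow> bool" where
  "sublinear q \<longleftrightarrow> (\<forall>u v. q (u + v) \<le> q u + q v) \<and> (\<forall>c>0. \<forall>u. q (c *\<^sub>R u) = c * q u)"

lemma sublinear_add: "sublinear q \<Longrightarrow> q (u + v) \<le> q u + q v"
  and sublinear_scale: "sublinear q \<Longrightarrow> c > 0 \<Longrightarrow> q (c *\<^sub>R u) = c * q u"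
  by (auto simp: sublinear_def)

lemma sublinear_zero: "sublinear q \<Longrightarrow> q 0 = 0"
  using sublinear_scale[of q 2 0] by simp

lemma sublinear_neg: "sublinear q \<Longrightarrow> - q (- v) \<le> q v"
  using sublinear_add[of q v "- v"] sublinear_zero[of q] by simp

lemma sublinear_norm: "sublinear norm"
  by (auto simp: sublinear_def norm_triangle_ineq)

lemma linear_le_imp_ge_neg:
  fixes f :: "'a::real_vector \<Rightarrow> real"
  assumes "linear f" "f \<le> q"
  shows "- q (- v) \<le> f v"
  using le_funD[OF assms(2), of "- v"] linear_neg[OF assms(1), of v] by simp

text \<open>
  The difference quotients of a sublinear functional increase with \<open>t\<close>, so that the infimum is
  the limit for \<open>t \<rightarrow> 0\<close> from the right.
\<close>

definition dir_deriv :: "('a::real_vector \<Rightarrow> real) \<Rightarrow> 'a \<Rightarrow> 'a \<Rightarrow> real" where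
  "dir_deriv q v w = (INF t\<in>{0<..}. (q (v + t *\<^sub>R w) - q v) / t)"

lemma dir_deriv_quotient_ge:
  assumes "sublinear q" "t > 0"
  shows "- q (- w) \<le> (q (v + t *\<^sub>R w) - q v) / t"
proof -
  have "q v \<le> q (v + t *\<^sub>R w) + q (t *\<^sub>R (- w))"
    using sublinear_add[OF assms(1), of "v + t *\<^sub>R w" "t *\<^sub>R (- w)"] by simp
  then show ?thesis
    using sublinear_scale[OF assms, of "- w"] assms(2) by (simp add: field_simps)
qed

lemma dir_deriv_le_quotient:
  assumes "sublinear q" "t > 0"
  shows "dir_deriv q v w \<le> (q (v + t *\<^sub>R w) - q v) / t"
  unfolding dir_deriv_def
  by (rule cINF_lower) (use assms dir_deriv_quotient_ge[OF assms(1)] in \<open>auto intro!: bdd_belowI2\<close>)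

lemma dir_deriv_greatest:
  assumes "\<And>t. t > 0 \<Longrightarrow> c \<le> (q (v + t *\<^sub>R w) - q v) / t"
  shows "c \<le> dir_deriv q v w"
  unfolding dir_deriv_def using assms by (intro cINF_greatest) (auto intro: exI[of _ 1])

lemma dir_deriv_le:
  assumes "sublinear q"
  shows "dir_deriv q v \<le> q"
proof (rule le_funI)
  fix w
  show "dir_deriv q v w \<le> q w"
    using dir_deriv_le_quotient[OF assms, of 1 v w] sublinear_add[OF assms, of v w] by simp
qed

lemma dir_deriv_backwards:
  assumes "sublinear q"
  shows "dir_deriv q v (- v) \<le> - q v"
  using dir_deriv_le_quotient[OF assms, of 1 v "- v"] sublinear_zero[OF assms] by simp

lemma linear_le_dir_deriv:
  fixes f :: "'a::real_vector \<Rightarrow> real"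
  assumes "linear f" "f \<le> q" "f v = q v"
  shows "f \<le> dir_deriv q v"
proof (intro le_funI dir_deriv_greatest)
  fix w and t :: real assume "t > 0"
  then show "f w \<le> (q (v + t *\<^sub>R w) - q v) / t"
    using le_funD[OF assms(2), of "v + t *\<^sub>R w"] assms(3)
    by (simp add: linear_add[OF assms(1)] linear_scale[OF assms(1)] field_simps)
qed

text \<open>
  In terms of the convex set of linear functionals dominated by \<open>q\<close>, passing from \<open>q\<close> to its
  derivative at \<open>v\<close> means passing to the exposed face on which evaluation at \<open>v\<close> is maximal.
\<close>

lemma linear_le_dir_deriv_iff:
  fixes f :: "'a::real_vector \<Rightarrow> real"
  assumes "sublinear q" "linear f"
  shows "f \<le> dir_deriv q v \<longleftrightarrow> f \<le> q \<and> f v = q v"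
proof
  assume le: "f \<le> dir_deriv q v"
  then have "f \<le> q"
    using dir_deriv_le[OF assms(1)] by (rule order_trans)
  moreover have "q v \<le> f v"
    using linear_le_imp_ge_neg[OF assms(2) le, of v] dir_deriv_backwards[OF assms(1), of v] by simp
  ultimately show "f \<le> q \<and> f v = q v"
    by (auto simp: le_fun_def intro: antisym)
qed (use assms linear_le_dir_deriv in auto)

lemma sublinear_dir_deriv:
  assumes q: "sublinear q"
  shows "sublinear (dir_deriv q v)"
  unfolding sublinear_def
proof (intro conjI allI impI)
  fix w1 w2
  \<comment> \<open>The step for \<open>w1 + w2\<close> is half the harmonic mean of \<open>s\<close> and \<open>t\<close>: this makes the point a
    convex combination of the other two.\<close>
  have *: "dir_deriv q v (w1 + w2) \<le> (q (v + s *\<^sub>R w1) - q v) / s + (q (v + t *\<^sub>R w2) - q v) / t"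
    if st: "s > 0" "t > 0" for s t :: real
  proof -
    define a b where "a = t / (s + t)" and "b = s / (s + t)"
    have ab: "a > 0" "b > 0" "a + b = 1" "a * s = b * t"
      using st by (auto simp: a_def b_def add_divide_distrib[symmetric])
    have "v + (a * s) *\<^sub>R (w1 + w2) = a *\<^sub>R (v + s *\<^sub>R w1) + b *\<^sub>R (v + t *\<^sub>R w2)"
      using ab(3,4) scaleR_add_left[of a b v] by (simp add: algebra_simps)
    then have "q (v + (a * s) *\<^sub>R (w1 + w2)) \<le> a * q (v + s *\<^sub>R w1) + b * q (v + t *\<^sub>R w2)"
      using sublinear_add[OF q, of "a *\<^sub>R (v + s *\<^sub>R w1)" "b *\<^sub>R (v + t *\<^sub>R w2)"]
        sublinear_scale[OF q] ab by simp
    also have "\<dots> = q v + a * (q (v + s *\<^sub>R w1) - q v) + b * (q (v + t *\<^sub>R w2) - q v)"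
      using distrib_right[of a b "q v"] ab(3) by (simp add: algebra_simps)
    finally have "(q (v + (a * s) *\<^sub>R (w1 + w2)) - q v) / (a * s)
        \<le> (a * (q (v + s *\<^sub>R w1) - q v) + b * (q (v + t *\<^sub>R w2) - q v)) / (a * s)"
      using ab st by (intro divide_right_mono) auto
    also have "\<dots> = a * (q (v + s *\<^sub>R w1) - q v) / (a * s) + b * (q (v + t *\<^sub>R w2) - q v) / (b * t)"
      by (simp only: add_divide_distrib ab(4))
    also have "\<dots> = (q (v + s *\<^sub>R w1) - q v) / s + (q (v + t *\<^sub>R w2) - q v) / t"
      using ab(1,2) by simp
    finally show ?thesis
      using dir_deriv_le_quotient[OF q, of "a * s" v "w1 + w2"] ab st by simp
  qed
  have "dir_deriv q v (w1 + w2) - (q (v + t *\<^sub>R w2) - q v) / t \<le> dir_deriv q v w1" if "t > 0" for t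
    using *[OF _ that] by (intro dir_deriv_greatest) (simp add: algebra_simps)
  then have "dir_deriv q v (w1 + w2) - dir_deriv q v w1 \<le> dir_deriv q v w2"
    by (intro dir_deriv_greatest) (simp add: algebra_simps)
  then show "dir_deriv q v (w1 + w2) \<le> dir_deriv q v w1 + dir_deriv q v w2"
    by simp
next
  have *: "c * dir_deriv q v w \<le> dir_deriv q v (c *\<^sub>R w)" if "c > 0" for c :: real and w
  proof (rule dir_deriv_greatest)
    fix t :: real assume "t > 0"
    then show "c * dir_deriv q v w \<le> (q (v + t *\<^sub>R c *\<^sub>R w) - q v) / t"
      using dir_deriv_le_quotient[OF q, of "t * c" v w] that by (simp add: field_simps)
  qed
  fix c :: real and w assume "c > 0"
  then show "dir_deriv q v (c *\<^sub>R w) = c * dir_deriv q v w"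
    using *[of c w] *[of "inverse c" "c *\<^sub>R w"] by (intro antisym) (auto simp: field_simps)
qed

section \<open>Extreme dominated functionals\<close>

text \<open>
  Sublinear functionals \<open>q \<le> p\<close> stand for weak-star closed convex sets of linear functionals
  dominated by \<open>p\<close>; the last condition says that the set that belongs to \<open>q\<close> is a face (an extremal
  subset) of the one that belongs to \<open>p\<close>. Working with \<open>q\<close> instead of the set allows passing to a
  limit along a chain of faces without a compactness argument, and without knowing beforehand that
  the sets are non-empty.
\<close>

definition face_functional :: "('a::real_vector \<Rightarrow> real) \<Rightarrow> ('a \<Rightarrow> real) \<Rightarrow> bool" where
  "face_functional p q \<longleftrightarrow> sublinear q \<and> q \<le> p \<and>
     (\<forall>a b \<mu>. linear a \<and> linear b \<and> a \<le> p \<and> b \<le> p \<and> 0 < \<mu> \<and> \<mu> < 1 \<and>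
        (\<lambda>v. (1 - \<mu>) * a v + \<mu> * b v) \<le> q \<longrightarrow> a \<le> q \<and> b \<le> q)"

lemma face_functionalD:
  assumes "face_functional p q" "linear a" "linear b" "a \<le> p" "b \<le> p" "0 < \<mu>" "\<mu> < 1"
    "(\<lambda>v. (1 - \<mu>) * a v + \<mu> * b v) \<le> q"
  shows "a \<le> q" "b \<le> q"
  using assms unfolding face_functional_def by blast+

lemma face_functional_self: "sublinear p \<Longrightarrow> face_functional p p"
  by (auto simp: face_functional_def)

text \<open>
  An exposed face of a face is a face: if a proper convex combination of \<open>a\<close> and \<open>b\<close> attains the
  maximum \<open>q v\<close>, then so do both \<open>a\<close> and \<open>b\<close>.
\<close>

lemma face_functional_dir_deriv:
  assumes face: "face_functional p q"
  shows "face_functional p (dir_deriv q v)"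
  unfolding face_functional_def
proof (intro conjI allI impI)
  have q: "sublinear q" "q \<le> p"
    using face by (auto simp: face_functional_def)
  show "sublinear (dir_deriv q v)" "dir_deriv q v \<le> p"
    using sublinear_dir_deriv[OF q(1)] dir_deriv_le[OF q(1), of v] q(2) by auto
  fix a b :: "'a \<Rightarrow> real" and \<mu> :: real
  let ?m = "\<lambda>v. (1 - \<mu>) * a v + \<mu> * b v"
  assume H: "linear a \<and> linear b \<and> a \<le> p \<and> b \<le> p \<and> 0 < \<mu> \<and> \<mu> < 1 \<and> ?m \<le> dir_deriv q v"
  then have lin: "linear a" "linear b" and \<mu>: "0 < \<mu>" "\<mu> < 1" by auto
  have "linear ?m"
    using lin by (intro linearI) (auto simp: linear_add linear_scale algebra_simps)
  then have m: "?m \<le> q" "?m v = q v"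
    using linear_le_dir_deriv_iff[OF q(1)] H by auto
  have ab: "a \<le> q" "b \<le> q"
    using face_functionalD[OF face lin _ _ \<mu> m(1)] H by auto
  have *: "(1 - \<mu>) * (q v - a v) \<ge> 0" "\<mu> * (q v - b v) \<ge> 0"
    using ab \<mu> by (auto simp: le_fun_def)
  moreover have "(1 - \<mu>) * (q v - a v) + \<mu> * (q v - b v) = 0"
    using m(2) by (simp add: algebra_simps)
  ultimately have "(1 - \<mu>) * (q v - a v) = 0" "\<mu> * (q v - b v) = 0"
    by linarith+
  then have "a v = q v" "b v = q v"
    using \<mu> by auto
  then show "a \<le> dir_deriv q v" "b \<le> dir_deriv q v"
    using linear_le_dir_deriv lin ab by auto
qed

text \<open>
  The bound \<open>- p (- v)\<close> keeps the infimum finite. Totality of the order gives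
  subadditivity, since a bound by one \<open>q u\<close> and one \<open>r v\<close> can be checked at the smaller of \<open>q\<close>
  and \<open>r\<close>.
\<close>

lemma face_functional_INF:
  assumes C: "C \<noteq> {}" "\<And>q. q \<in> C \<Longrightarrow> face_functional p q"
    and chain: "\<And>q r. q \<in> C \<Longrightarrow> r \<in> C \<Longrightarrow> q \<le> r \<or> r \<le> q"
  defines "m \<equiv> \<lambda>v. INF q\<in>C. q v"
  shows "face_functional p m" "\<And>q. q \<in> C \<Longrightarrow> m \<le> q"
proof -
  have bdd: "bdd_below ((\<lambda>q. q v) ` C)" for v
  proof (rule bdd_belowI2)
    fix q assume "q \<in> C"
    then have "sublinear q" "q (- v) \<le> p (- v)"
      using C(2) by (auto simp: face_functional_def le_fun_def)
    then show "- p (- v) \<le> q v"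
      using sublinear_neg[of q v] by linarith
  qed
  have lower: "m v \<le> q v" if "q \<in> C" for q v
    unfolding m_def by (rule cINF_lower[OF bdd that])
  have greatest: "c \<le> m v" if "\<And>q. q \<in> C \<Longrightarrow> c \<le> q v" for c v
    unfolding m_def by (rule cINF_greatest[OF C(1) that])
  show "m \<le> q" if "q \<in> C" for q
    using lower[OF that] by (rule le_funI)
  have sub: "sublinear q" if "q \<in> C" for q
    using C(2)[OF that] by (simp add: face_functional_def)
  show "face_functional p m"
    unfolding face_functional_def
  proof (intro conjI allI impI)
    show "sublinear m"
      unfolding sublinear_def
    proof (intro conjI allI impI)
      fix u v
      have "m (u + v) \<le> q u + r v" if qr: "q \<in> C" "r \<in> C" for q r
        using chain[OF qr]
      proof
        assume "q \<le> r"
        then show ?thesis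
          using lower[OF qr(1), of "u + v"] sublinear_add[OF sub[OF qr(1)], of u v] le_funD[of q r v]
          by linarith
      next
        assume "r \<le> q"
        then show ?thesis
          using lower[OF qr(2), of "u + v"] sublinear_add[OF sub[OF qr(2)], of u v] le_funD[of r q u]
          by linarith
      qed
      then have "m (u + v) - r v \<le> m u" if "r \<in> C" for r
        using that by (intro greatest) (simp add: algebra_simps)
      then have "m (u + v) - m u \<le> m v"
        by (intro greatest) (simp add: algebra_simps)
      then show "m (u + v) \<le> m u + m v"
        by simp
    next
      have *: "c * m u \<le> m (c *\<^sub>R u)" if "c > 0" for c :: real and u
      proof (rule greatest)
        fix q assume "q \<in> C"
        then show "c * m u \<le> q (c *\<^sub>R u)"
          using lower[of q u] sublinear_scale[OF sub that, of q u] that by simp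
      qed
      fix c :: real and u assume "c > 0"
      then show "m (c *\<^sub>R u) = c * m u"
        using *[of c u] *[of "inverse c" "c *\<^sub>R u"] by (intro antisym) (auto simp: field_simps)
    qed
    obtain q where "q \<in> C"
      using C(1) by blast
    then show "m \<le> p"
      using lower[of q] C(2)[of q] by (auto simp: face_functional_def le_fun_def intro: order_trans)
  next
    fix a b :: "'a \<Rightarrow> real" and \<mu> :: real
    assume H: "linear a \<and> linear b \<and> a \<le> p \<and> b \<le> p \<and> 0 < \<mu> \<and> \<mu> < 1 \<and>
      (\<lambda>v. (1 - \<mu>) * a v + \<mu> * b v) \<le> m"
    have *: "a \<le> q" "b \<le> q" if "q \<in> C" for q
    proof -
      have "(\<lambda>v. (1 - \<mu>) * a v + \<mu> * b v) \<le> q"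
        using H lower[OF that] by (auto simp: le_fun_def intro: order_trans)
      then show "a \<le> q" "b \<le> q"
        using face_functionalD[OF C(2)[OF that], of a b \<mu>] H by auto
    qed
    then show "a \<le> m" "b \<le> m"
      by (auto simp: le_fun_def intro!: greatest)
  qed
qed

text \<open>
  By Zorn's lemma there is a minimal face functional \<open>f\<close> below \<open>q\<close>. Differentiating \<open>f\<close> at any \<open>v\<close>
  gives another one below it, hence \<open>f\<close> itself; but the derivative at \<open>v\<close> in the direction \<open>- v\<close> is
  at most \<open>- f v\<close>. So \<open>f\<close> is odd, and an odd sublinear functional is linear. The face that belongs
  to it is a single point.
\<close>

lemma exists_linear_face_functional:
  assumes "face_functional p q"
  obtains f where "face_functional p f" "f \<le> q" "linear f"
proof -
  define A where "A = {r. face_functional p r \<and> r \<le> q}"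
  let ?R = "relation_of (\<lambda>r s. s \<le> r) A"
  have "\<exists>m\<in>A. \<forall>r\<in>A. r \<le> m \<longrightarrow> r = m"
  proof (rule predicate_Zorn)
    show "partial_order_on A ?R"
      by (rule partial_order_on_relation_ofI) auto
    fix C assume "C \<in> Chains ?R"
    then have C: "C \<subseteq> A" "\<And>r s. r \<in> C \<Longrightarrow> s \<in> C \<Longrightarrow> r \<le> s \<or> s \<le> r"
      by (auto simp: Chains_def relation_of_def)
    show "\<exists>u\<in>A. \<forall>r\<in>C. u \<le> r"
    proof (cases "C = {}")
      case True
      then show ?thesis using assms by (auto simp: A_def)
    next
      case False
      have face: "face_functional p r" if "r \<in> C" for r
        using C(1) that by (auto simp: A_def)
      let ?m = "\<lambda>v. INF r\<in>C. r v"
      have m: "face_functional p ?m" "\<And>r. r \<in> C \<Longrightarrow> ?m \<le> r"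
        using face_functional_INF[OF False face C(2)] by auto
      obtain r where "r \<in> C" using False by blast
      then have "?m \<le> q"
        using order_trans[OF m(2), of r q] C(1) by (auto simp: A_def)
      then show ?thesis
        using m by (auto simp: A_def intro!: bexI[of _ ?m])
    qed
  qed
  then obtain f where f: "face_functional p f" "f \<le> q"
    and min: "\<And>r. face_functional p r \<Longrightarrow> r \<le> f \<Longrightarrow> r = f"
    unfolding A_def by (auto intro: order_trans)
  have sub: "sublinear f"
    using f(1) by (simp add: face_functional_def)
  have "f (- v) = - f v" for v
  proof -
    have "dir_deriv f v = f"
      by (intro min face_functional_dir_deriv f(1) dir_deriv_le sub)
    then show ?thesis
      using dir_deriv_backwards[OF sub, of v] sublinear_neg[OF sub, of "- v"] by simp
  qed
  note neg = this
  have "linear f"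
  proof (rule linearI)
    fix u v
    show "f (u + v) = f u + f v"
      using sublinear_add[OF sub, of u v] sublinear_add[OF sub, of "- u" "- v"] neg[of "u + v"]
        neg[of u] neg[of v] by simp
    fix c :: real
    show "f (c *\<^sub>R u) = c *\<^sub>R f u"
    proof (cases c "0::real" rule: linorder_cases)
      case less
      then show ?thesis
        using sublinear_scale[OF sub, of "- c" u] neg[of "c *\<^sub>R u"] by simp
    qed (use sublinear_scale[OF sub] sublinear_zero[OF sub] in auto)
  qed
  with f that show ?thesis by blast
qed

section \<open>Extreme norming functionals\<close>

lemma norming_functionals_iff:
  fixes f :: "'a::real_normed_vector \<Rightarrow>\<^sub>L real"
  assumes "norm x = 1"
  shows "f \<in> norming_functionals x \<longleftrightarrow> blinfun_apply f \<le> dir_deriv norm x"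
proof -
  have "f \<in> norming_functionals x \<longleftrightarrow> blinfun_apply f \<le> norm \<and> blinfun_apply f x = norm x"
  proof
    assume "f \<in> norming_functionals x"
    then have f: "norm f = 1" "blinfun_apply f x = 1"
      by (auto simp: norming_functionals_def)
    have "blinfun_apply f v \<le> norm v" for v
      using norm_blinfun[of f v] f(1) by simp
    with f assms show "blinfun_apply f \<le> norm \<and> blinfun_apply f x = norm x"
      by (auto simp: le_fun_def)
  next
    assume f: "blinfun_apply f \<le> norm \<and> blinfun_apply f x = norm x"
    have "norm (blinfun_apply f v) \<le> 1 * norm v" for v
      using f le_funD[of "blinfun_apply f" norm v] le_funD[of "blinfun_apply f" norm "- v"]
      by (simp add: blinfun.minus_right abs_le_iff)
    then have "norm f \<le> 1"
      by (intro norm_blinfun_bound) auto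
    moreover have "1 \<le> norm f"
      using norm_blinfun[of f x] f assms by simp
    ultimately show "f \<in> norming_functionals x"
      using f assms by (auto simp: norming_functionals_def)
  qed
  also have "\<dots> \<longleftrightarrow> blinfun_apply f \<le> dir_deriv norm x"
    using linear_le_dir_deriv_iff[OF sublinear_norm, of "blinfun_apply f" x]
    by (simp add: bounded_linear.linear[OF blinfun.bounded_linear_right])
  finally show ?thesis .
qed

text \<open>
  A linear face functional below the derivative of \<open>p\<close> at \<open>u\<close>, where \<open>p\<close> is the derivative of the
  norm at \<open>x\<close>, agrees with \<open>p\<close> at \<open>u\<close>, and being a face consisting of one point means being an
  extreme point.
\<close>

lemma exists_extreme_norming_functional:
  fixes x u :: "'a::real_normed_vector"
  assumes x: "norm x = 1"
  obtains f where "f extreme_point_of norming_functionals x" "blinfun_apply f u = dir_deriv norm x u"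
proof -
  let ?p = "dir_deriv norm x"
  have p: "sublinear ?p"
    by (rule sublinear_dir_deriv[OF sublinear_norm])
  obtain g where g: "face_functional ?p g" "g \<le> dir_deriv ?p u" "linear g"
    using exists_linear_face_functional[OF face_functional_dir_deriv[OF face_functional_self[OF p]]] by blast
  have gp: "g \<le> ?p" and gu: "g u = ?p u"
    using linear_le_dir_deriv_iff[OF p g(3)] g(2) by auto
  have gn: "g \<le> norm"
    using gp dir_deriv_le[OF sublinear_norm] by (rule order_trans)
  have "norm (g v) \<le> norm v * 1" for v
    using le_funD[OF gn, of v] le_funD[OF gn, of "- v"] linear_neg[OF g(3), of v]
    by (simp add: abs_le_iff)
  then have "bounded_linear g"
    by (intro bounded_linear_intro[of g 1]) (auto simp: linear_add[OF g(3)] linear_scale[OF g(3)])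
  then have app: "blinfun_apply (Blinfun g) = g"
    by (rule bounded_linear_Blinfun_apply)
  have "Blinfun g extreme_point_of norming_functionals x"
    unfolding extreme_point_of_def
  proof (intro conjI ballI notI)
    show "Blinfun g \<in> norming_functionals x"
      using gp app by (simp add: norming_functionals_iff[OF x])
    fix a b assume ab: "a \<in> norming_functionals x" "b \<in> norming_functionals x"
      and "Blinfun g \<in> open_segment a b"
    then obtain \<mu> where \<mu>: "0 < \<mu>" "\<mu> < 1" "a \<noteq> b" "Blinfun g = (1 - \<mu>) *\<^sub>R a + \<mu> *\<^sub>R b"
      by (auto simp: in_segment)
    have "g = (\<lambda>v. (1 - \<mu>) * blinfun_apply a v + \<mu> * blinfun_apply b v)"
      using arg_cong[OF \<mu>(4), of blinfun_apply] by (simp add: app fun_eq_iff blinfun.bilinear_simps)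
    then have le: "blinfun_apply a \<le> g" "blinfun_apply b \<le> g"
      using face_functionalD[OF g(1) _ _ _ _ \<mu>(1,2), of "blinfun_apply a" "blinfun_apply b"] ab
      by (auto simp: norming_functionals_iff[OF x] bounded_linear.linear[OF blinfun.bounded_linear_right])
    have eq: "blinfun_apply h = g" if "blinfun_apply h \<le> g" for h
    proof (intro ext antisym)
      fix v
      show "blinfun_apply h v \<le> g v" "g v \<le> blinfun_apply h v"
        using le_funD[OF that, of v] le_funD[OF that, of "- v"] linear_neg[OF g(3), of v]
        by (auto simp: blinfun.minus_right)
    qed
    show False
      using eq[OF le(1)] eq[OF le(2)] \<open>a \<noteq> b\<close> by (metis blinfun_apply_inject)
  qed
  with gu app that show ?thesis by metis
qed

lemma dir_deriv_nonpos_if_extreme_nonpos: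
  fixes x u :: "'a::real_normed_vector"
  assumes "norm x = 1" "\<And>f. f extreme_point_of norming_functionals x \<Longrightarrow> blinfun_apply f u \<le> 0"
  shows "dir_deriv norm x u \<le> 0"
  using exists_extreme_norming_functional[OF assms(1), of u] assms(2) by metis

text \<open>
  When a new functional \<open>h\<close> ties with the current winner \<open>f\<close> at \<open>v\<close>, a small perturbation of \<open>v\<close>
  towards a vector that separates the two breaks the tie and preserves the finitely many
  strict inequalities already achieved.
\<close>

lemma finite_functionals_strict_max:
  fixes E :: "('a::real_normed_vector \<Rightarrow>\<^sub>L real) set"
  assumes "finite E" "E \<noteq> {}"
  shows "\<exists>f\<in>E. \<exists>v. \<forall>g\<in>E - {f}. blinfun_apply g v < blinfun_apply f v"
  using assms
proof (induction rule: finite_ne_induct)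
  case (singleton f)
  then show ?case by auto
next
  case (insert h E)
  then obtain f v where f: "f \<in> E" "\<And>g. g \<in> E - {f} \<Longrightarrow> blinfun_apply g v < blinfun_apply f v"
    by blast
  consider "blinfun_apply h v < blinfun_apply f v" | "blinfun_apply h v > blinfun_apply f v"
    | "blinfun_apply h v = blinfun_apply f v"
    by linarith
  then show ?case
  proof cases
    case 1
    then have "\<forall>g\<in>insert h E - {f}. blinfun_apply g v < blinfun_apply f v"
      using f by auto
    then show ?thesis using f(1) by blast
  next
    case 2
    have "blinfun_apply g v < blinfun_apply h v" if "g \<in> E" for g
      using 2 f(2)[of g] that by (cases "g = f") auto
    then have "\<forall>g\<in>insert h E - {h}. blinfun_apply g v < blinfun_apply h v"
      by auto
    then show ?thesis by blast
  next
    case 3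
    have "h \<noteq> f" using f(1) insert by auto
    then obtain w' where "blinfun_apply h w' \<noteq> blinfun_apply f w'"
      using blinfun_eqI[of h f] by blast
    then have "blinfun_apply h w' < blinfun_apply f w' \<or> blinfun_apply h (- w') < blinfun_apply f (- w')"
      by (auto simp: blinfun.minus_right)
    then obtain w where w: "blinfun_apply h w < blinfun_apply f w"
      by blast
    have "\<forall>\<^sub>F s in at_right 0. \<forall>g\<in>E - {f}. blinfun_apply g (v + s *\<^sub>R w) < blinfun_apply f (v + s *\<^sub>R w)"
    proof (rule eventually_ball_finite)
      show "finite (E - {f})" using insert by auto
      show "\<forall>g\<in>E - {f}. \<forall>\<^sub>F s in at_right 0. blinfun_apply g (v + s *\<^sub>R w) < blinfun_apply f (v + s *\<^sub>R w)"
      proof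
        fix g assume "g \<in> E - {f}"
        then have g: "blinfun_apply (g - f) v < 0"
          using f(2) by (simp add: blinfun.diff_left)
        have "((\<lambda>s. blinfun_apply (g - f) (v + s *\<^sub>R w)) \<longlongrightarrow> blinfun_apply (g - f) (v + 0 *\<^sub>R w)) (at_right 0)"
          by (intro tendsto_intros)
        then have "\<forall>\<^sub>F s in at_right 0. blinfun_apply (g - f) (v + s *\<^sub>R w) < 0"
          using g by (intro order_tendstoD(2)[where y = "blinfun_apply (g - f) v"]) auto
        then show "\<forall>\<^sub>F s in at_right 0. blinfun_apply g (v + s *\<^sub>R w) < blinfun_apply f (v + s *\<^sub>R w)"
          by (simp add: blinfun.diff_left)
      qed
    qed
    then have "\<forall>\<^sub>F s in at_right 0. s > 0 \<and>
        (\<forall>g\<in>E - {f}. blinfun_apply g (v + s *\<^sub>R w) < blinfun_apply f (v + s *\<^sub>R w))"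
      using eventually_at_right_less[of 0] by eventually_elim simp
    then obtain s where s: "s > 0"
      "\<And>g. g \<in> E - {f} \<Longrightarrow> blinfun_apply g (v + s *\<^sub>R w) < blinfun_apply f (v + s *\<^sub>R w)"
      using eventually_happens'[OF trivial_limit_at_right_real] by blast
    have "blinfun_apply h (v + s *\<^sub>R w) < blinfun_apply f (v + s *\<^sub>R w)"
      using 3 w s(1) by (simp add: blinfun.bilinear_simps)
    then have "\<forall>g\<in>insert h E - {f}. blinfun_apply g (v + s *\<^sub>R w) < blinfun_apply f (v + s *\<^sub>R w)"
      using s(2) by auto
    then show ?thesis using f(1) by blast
  qed
qed

section \<open>Polyhedral planes\<close>

text \<open>
  The hypothesis \<open>approx\<close> says that the direction \<open>u\<close> is tangential to \<open>P\<close> at \<open>p\<close> up to arbitrarily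
  small error. A half-space that contains \<open>p\<close> in its interior also contains short steps in any
  direction; a half-space with \<open>p\<close> on its boundary must contain the whole ray, because the error
  \<open>e\<close> can be sent to 0. Finitely many half-spaces admit a common step.
\<close>

lemma polyhedron_step:
  fixes P :: "'a::euclidean_space set"
  assumes P: "polyhedron P" "p \<in> P"
    and approx: "\<And>e. e > 0 \<Longrightarrow> \<exists>t>0. (1 / (1 + t * e)) *\<^sub>R (p + t *\<^sub>R u) \<in> P"
  shows "\<exists>t>0. p + t *\<^sub>R u \<in> P"
proof -
  obtain F where F: "finite F" "P = \<Inter>F" "\<And>h. h \<in> F \<Longrightarrow> \<exists>a b. a \<noteq> 0 \<and> h = {x. a \<bullet> x \<le> b}"
    using P(1) unfolding polyhedron_def by blast
  have "\<forall>\<^sub>F t in at_right 0. \<forall>h\<in>F. p + t *\<^sub>R u \<in> h"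
  proof (rule eventually_ball_finite[OF F(1)], rule ballI)
    fix h assume h: "h \<in> F"
    then obtain a b where ab: "h = {x. a \<bullet> x \<le> b}"
      using F(3) by blast
    have Ph: "a \<bullet> z \<le> b" if "z \<in> P" for z
      using that h F(2) ab by auto
    show "\<forall>\<^sub>F t in at_right 0. p + t *\<^sub>R u \<in> h"
    proof (cases "a \<bullet> p < b")
      case True
      have "((\<lambda>t. a \<bullet> (p + t *\<^sub>R u)) \<longlongrightarrow> a \<bullet> (p + 0 *\<^sub>R u)) (at_right 0)"
        by (intro tendsto_intros)
      then have "\<forall>\<^sub>F t in at_right 0. a \<bullet> (p + t *\<^sub>R u) < b"
        using True by (intro order_tendstoD(2)[where y = "a \<bullet> p"]) auto
      then show ?thesis
        by eventually_elim (simp add: ab)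
    next
      case False
      then have eq: "a \<bullet> p = b" using Ph[OF P(2)] by simp
      have le: "a \<bullet> u \<le> b * e" if e: "e > 0" for e
      proof -
        obtain t where t: "t > 0" "(1 / (1 + t * e)) *\<^sub>R (p + t *\<^sub>R u) \<in> P"
          using approx[OF e] by blast
        have "1 + t * e > 0" using t e by (simp add: add_pos_pos)
        then have "a \<bullet> (p + t *\<^sub>R u) \<le> b * (1 + t * e)"
          using Ph[OF t(2)] by (simp add: pos_divide_le_eq del: inner_add_right)
        then have "t * (a \<bullet> u) \<le> t * (b * e)"
          using eq by (simp add: algebra_simps)
        then show ?thesis using t(1) by simp
      qed
      have "((\<lambda>e. b * e) \<longlongrightarrow> b * 0) (at_right 0)"
        by (intro tendsto_intros)
      then have "a \<bullet> u \<le> b * 0"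
        by (rule tendsto_lowerbound)
          (use le in \<open>auto intro: eventually_mono[OF eventually_at_right_less[of 0]] simp: trivial_limit_at_right_real\<close>)
      then have "p + t *\<^sub>R u \<in> h" if "t > 0" for t
        using eq that by (simp add: ab inner_add_right mult_nonneg_nonpos)
      then show ?thesis
        using eventually_at_right_less[of "0::real"] by (auto elim: eventually_mono)
    qed
  qed
  then have "\<forall>\<^sub>F t in at_right 0. t > 0 \<and> p + t *\<^sub>R u \<in> P"
    using eventually_at_right_less[of 0] by eventually_elim (auto simp: F(2))
  then show ?thesis
    using eventually_happens'[OF trivial_limit_at_right_real] by blast
qed

lemma polytope_linear_vimage:
  fixes L :: "'a::real_vector \<Rightarrow> 'b::real_vector"
  assumes L: "linear L" "inj L" and P: "polytope P" "P \<subseteq> range L"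
  shows "polytope (L -` P)"
proof -
  obtain A where A: "finite A" "P = convex hull A"
    using P(1) by (auto simp: polytope_def)
  then have "A \<subseteq> range L"
    using hull_subset[of A convex] P(2) by blast
  then have "A = L ` (L -` A)"
    by auto
  then have "P = L ` (convex hull (L -` A))"
    using convex_hull_linear_image[OF L(1), of "L -` A"] A(2) by simp
  then have "L -` P = convex hull (L -` A)"
    using L(2) by (simp add: inj_vimage_image_eq)
  moreover have "finite (L -` A)"
    using A(1) L(2) by (rule finite_vimageI)
  ultimately show ?thesis
    by (auto simp: polytope_def)
qed

text \<open>
  Polyhedra are described by half-spaces in Euclidean spaces, so the plane spanned by \<open>x\<close> and \<open>u\<close> is
  pulled back to \<open>\<real>\<^sup>2\<close>. If \<open>u\<close> is a multiple of \<open>x\<close>, there is no plane, and the norm along the line is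
  explicit.
\<close>

lemma K_polyhedral_step:
  fixes x u :: "'a::real_normed_vector"
  assumes K: "K_polyhedral TYPE('a)" and x: "norm x = 1" and d: "dir_deriv norm x u \<le> 0"
  shows "\<exists>t>0. norm (x + t *\<^sub>R u) \<le> 1"
proof -
  have approx: "\<exists>t>0. norm (x + t *\<^sub>R u) \<le> 1 + t * e" if "e > 0" for e
  proof -
    have "\<not> e \<le> dir_deriv norm x u" using d that by simp
    then obtain t where "t > 0" "(norm (x + t *\<^sub>R u) - norm x) / t < e"
      using dir_deriv_greatest[of e norm x u] by (meson not_le)
    then show ?thesis
      using x by (intro exI[of _ t]) (auto simp: field_simps)
  qed
  define L :: "real \<times> real \<Rightarrow> 'a" where "L z = fst z *\<^sub>R x + snd z *\<^sub>R u" for z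
  have L: "linear L"
    by (rule linearI) (auto simp: L_def algebra_simps)
  show ?thesis
  proof (cases "inj L")
    case True
    let ?Y = "span {x, u}"
    have range: "range L = ?Y"
    proof (intro equalityI subsetI)
      fix y assume "y \<in> ?Y"
      then obtain k k' where "y - k *\<^sub>R x = k' *\<^sub>R u"
        by (auto simp: span_breakdown_eq)
      then have "y = L (k, k')"
        by (simp add: L_def diff_eq_eq add.commute)
      then show "y \<in> range L" by simp
    next
      fix y assume "y \<in> range L"
      then show "y \<in> ?Y"
        by (force simp: L_def intro: span_add span_scale span_base)
    qed
    have "polytope (cball 0 1 \<inter> ?Y)"
      by (rule K[unfolded K_polyhedral_def, rule_format])
        (intro conjI exI[of _ "{x, u}"] subspace_span, auto)
    then have "polytope (L -` (cball 0 1 \<inter> ?Y))"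
      using range by (intro polytope_linear_vimage L True) auto
    then have poly: "polyhedron (L -` (cball 0 1 \<inter> ?Y))"
      by (rule polytope_imp_polyhedron)
    have mem: "z \<in> L -` (cball 0 1 \<inter> ?Y) \<longleftrightarrow> norm (L z) \<le> 1" for z
      using range by auto
    have Ls: "L ((1, 0) + t *\<^sub>R (0, 1)) = x + t *\<^sub>R u" for t
      by (simp add: L_def)
    have "\<exists>t>0. (1, 0) + t *\<^sub>R (0, 1) \<in> L -` (cball 0 1 \<inter> ?Y)"
    proof (rule polyhedron_step[OF poly])
      show "(1, 0) \<in> L -` (cball 0 1 \<inter> ?Y)"
        unfolding mem by (simp add: L_def x)
      fix e :: real assume e: "e > 0"
      then obtain t where t: "t > 0" "norm (x + t *\<^sub>R u) \<le> 1 + t * e"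
        using approx by blast
      have "1 + t * e > 0" using t e by (simp add: add_pos_pos)
      then have "norm (L ((1 / (1 + t * e)) *\<^sub>R ((1, 0) + t *\<^sub>R (0, 1)))) \<le> 1"
        unfolding linear_scale[OF L] Ls using t(2) by simp
      with t(1) show "\<exists>t>0. (1 / (1 + t * e)) *\<^sub>R ((1, 0) + t *\<^sub>R (0, 1)) \<in> L -` (cball 0 1 \<inter> ?Y)"
        unfolding mem by blast
    qed
    then show ?thesis
      unfolding mem Ls .
  next
    case False
    then obtain a b where ab: "a *\<^sub>R x + b *\<^sub>R u = 0" "(a, b) \<noteq> 0"
      by (auto simp: linear_injective_0[OF L] L_def)
    have "b \<noteq> 0"
    proof
      assume "b = 0"
      with ab have "a *\<^sub>R x = 0" "a \<noteq> 0" by (auto simp: zero_prod_def)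
      with x show False by auto
    qed
    have "b *\<^sub>R u = - (a *\<^sub>R x)"
      using ab(1) by (simp add: eq_neg_iff_add_eq_0 add.commute)
    then have "u = (1 / b) *\<^sub>R (- (a *\<^sub>R x))"
      using \<open>b \<noteq> 0\<close> by (metis divideR_right inverse_eq_divide)
    then have "u = (- a / b) *\<^sub>R x"
      by simp
    then obtain c where c: "u = c *\<^sub>R x" by blast
    have norm: "norm (x + t *\<^sub>R u) = \<bar>1 + t * c\<bar>" for t
    proof -
      have "x + t *\<^sub>R u = (1 + t * c) *\<^sub>R x" by (simp add: c algebra_simps)
      then show ?thesis by (simp add: x)
    qed
    have "c \<le> e" if "e > 0" for e
    proof -
      obtain t where t: "t > 0" "norm (x + t *\<^sub>R u) \<le> 1 + t * e"
        using approx[OF \<open>e > 0\<close>] by blast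
      then have "t * c \<le> t * e"
        unfolding norm by linarith
      then show ?thesis using t(1) by simp
    qed
    then have "c \<le> 0" by (rule field_le_epsilon[of c 0, simplified])
    then show ?thesis
      unfolding norm
      by (intro exI[of _ "1 / (1 + \<bar>c\<bar>)"]) (auto simp: field_simps abs_le_iff add_pos_nonneg)
  qed
qed

section \<open>Faces of the ball\<close>

lemma convex_body_cball: "convex_body (cball (0::'a::real_normed_vector) 1)"
  using interior_maximal[OF ball_subset_cball open_ball, of "0::'a" 1] by (force simp: convex_body_def)

lemma supporting_hyperplane_norming_functional:
  fixes x :: "'a::real_normed_vector"
  assumes x: "norm x = 1" and f: "f \<in> norming_functionals x"
  shows "supporting_hyperplane (cball 0 1) {y. blinfun_apply f y = 1}"
  unfolding supporting_hyperplane_def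
proof (intro exI conjI)
  have nf: "norm f = 1" "blinfun_apply f x = 1"
    using f by (auto simp: norming_functionals_def)
  then show "f \<noteq> 0" by auto
  have le: "blinfun_apply f y \<le> 1" if "y \<in> cball 0 1" for y
    using norm_blinfun[of f y] nf(1) that by simp
  then show "bdd_above (blinfun_apply f ` cball 0 1)"
    by (rule bdd_aboveI2)
  show "1 = (SUP y\<in>cball 0 1. blinfun_apply f y)"
    using le nf(2) x by (intro cSup_eq_maximum[symmetric]) (auto intro!: image_eqI[of _ _ x])
  show "{y. blinfun_apply f y = 1} \<inter> cball 0 1 \<noteq> {}"
    using nf(2) x by (auto intro!: exI[of _ x])
qed simp

text \<open>
  The set \<open>E\<close> consists of the extreme norming functionals. All of them take the value 1 at \<open>x\<close>, so
  subtracting a multiple of \<open>x\<close> from \<open>v\<close> shifts all their values at \<open>v\<close> equally, and a strict maximum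
  of \<open>f\<close> can be normalised to the value 0.
\<close>

lemma peak_functional:
  fixes x :: "'a::real_normed_vector"
  assumes K: "K_polyhedral TYPE('a)" and D: "property_Delta TYPE('a)" and x: "norm x = 1"
  obtains E f v where "finite E" "f \<in> E" "E \<subseteq> norming_functionals x" "blinfun_apply f v = 0"
    "\<And>g. g \<in> E - {f} \<Longrightarrow> blinfun_apply g v < 0"
    "\<And>u. (\<And>g. g \<in> E \<Longrightarrow> blinfun_apply g u \<le> 0) \<Longrightarrow> \<exists>t>0. norm (x + t *\<^sub>R u) \<le> 1"
proof -
  define E where "E = {f. f extreme_point_of norming_functionals x}"
  obtain h where "h extreme_point_of norming_functionals x"
    using exists_extreme_norming_functional[OF x, of 0] by blast
  then have E: "E \<noteq> {}" "E \<subseteq> norming_functionals x"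
    by (auto simp: E_def extreme_point_of_def)
  have "finite E"
    using D x by (simp add: E_def property_Delta_def)
  obtain f v where f: "f \<in> E" "\<And>g. g \<in> E - {f} \<Longrightarrow> blinfun_apply g v < blinfun_apply f v"
    using finite_functionals_strict_max[OF \<open>finite E\<close> E(1)] by blast
  have app: "blinfun_apply g (v - blinfun_apply f v *\<^sub>R x) = blinfun_apply g v - blinfun_apply f v"
    if "g \<in> E" for g
    using that E(2) by (auto simp: norming_functionals_def blinfun.bilinear_simps)
  show ?thesis
  proof (rule that[of E f "v - blinfun_apply f v *\<^sub>R x"])
    show "blinfun_apply f (v - blinfun_apply f v *\<^sub>R x) = 0"
      using app[OF f(1)] by simp
    show "blinfun_apply g (v - blinfun_apply f v *\<^sub>R x) < 0" if "g \<in> E - {f}" for g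
      using app[of g] f(2)[OF that] that by simp
    show "\<exists>t>0. norm (x + t *\<^sub>R u) \<le> 1" if "\<And>g. g \<in> E \<Longrightarrow> blinfun_apply g u \<le> 0" for u
      using that by (intro K_polyhedral_step K x dir_deriv_nonpos_if_extreme_nonpos) (auto simp: E_def)
  qed (use E f \<open>finite E\<close> in auto)
qed

text \<open>
  The point \<open>x + \<tau> (v + \<sigma> w)\<close> allows a move in the direction \<open>w\<close>, but its \<open>\<tau>\<close> may depend on \<open>w\<close>. Mixing
  it with \<open>x\<close> and \<open>x + t v\<close> transfers the move to the midpoint of the latter two, which is
  the same for all \<open>w\<close>.
\<close>

lemma convex_midpoint_push:
  fixes x v w :: "'a::real_vector"
  assumes C: "convex C" "x \<in> C" "x + t *\<^sub>R v \<in> C" "x + \<tau> *\<^sub>R (v + \<sigma> *\<^sub>R w) \<in> C"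
    and pos: "t > 0" "\<tau> > 0" "\<sigma> > 0"
  shows "\<exists>\<delta>>0. \<forall>s. 0 \<le> s \<and> s \<le> \<delta> \<longrightarrow> x + (t / 2) *\<^sub>R v + s *\<^sub>R w \<in> C"
proof -
  \<comment> \<open>The weights are \<open>a\<close> on the displaced point, \<open>c\<close> on \<open>x + t v\<close> and the rest on \<open>x\<close>; \<open>c\<close> is chosen such
    that the \<open>v\<close>-component comes out as \<open>t / 2\<close>, and \<open>a\<close> small enough for \<open>c\<close> to be non-negative.\<close>
  define a where "a = min (1 / 2) (t / (2 * \<tau>))"
  have a: "a > 0" "a \<le> 1 / 2" "a * \<tau> \<le> t / 2"
    using pos by (auto simp: a_def min_def field_simps)
  define c where "c = 1 / 2 - a * \<tau> / t"
  have c: "c \<ge> 0" "c \<le> 1 / 2" "a * \<tau> + c * t = t / 2"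
    using a pos by (auto simp: c_def field_simps)
  define \<delta> where "\<delta> = a * \<tau> * \<sigma>"
  have \<delta>: "\<delta> > 0" using a pos by (simp add: \<delta>_def)
  have mid: "x + (t / 2) *\<^sub>R v \<in> C"
  proof -
    have "(1 / 2) *\<^sub>R x + (1 / 2) *\<^sub>R (x + t *\<^sub>R v) \<in> C"
      using C by (intro convexD) auto
    moreover have "(1 / 2) *\<^sub>R x + (1 / 2) *\<^sub>R (x + t *\<^sub>R v) = x + (t / 2) *\<^sub>R v"
      using scaleR_add_left[of "1/2" "1/2" x] by (simp add: algebra_simps)
    ultimately show ?thesis by simp
  qed
  have push: "x + (t / 2) *\<^sub>R v + \<delta> *\<^sub>R w \<in> C"
  proof -
    have "(\<Sum>i\<in>{0,1,2::nat}. (if i = 0 then 1 - a - c else if i = 1 then a else c) *\<^sub>R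
        (if i = 0 then x else if i = 1 then x + \<tau> *\<^sub>R (v + \<sigma> *\<^sub>R w) else x + t *\<^sub>R v)) \<in> C"
      using C a c by (intro convex_sum) auto
    then have "(1 - a - c) *\<^sub>R x + (a *\<^sub>R (x + \<tau> *\<^sub>R (v + \<sigma> *\<^sub>R w)) + c *\<^sub>R (x + t *\<^sub>R v)) \<in> C"
      by simp
    also have "(1 - a - c) *\<^sub>R x + (a *\<^sub>R (x + \<tau> *\<^sub>R (v + \<sigma> *\<^sub>R w)) + c *\<^sub>R (x + t *\<^sub>R v))
        = x + (a * \<tau> + c * t) *\<^sub>R v + \<delta> *\<^sub>R w"
      by (simp add: \<delta>_def algebra_simps)
    finally show ?thesis by (simp add: c(3))
  qed
  have "x + (t / 2) *\<^sub>R v + s *\<^sub>R w \<in> C" if s: "0 \<le> s" "s \<le> \<delta>" for s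
  proof -
    let ?y = "x + (t / 2) *\<^sub>R v"
    have "(1 - s / \<delta>) *\<^sub>R ?y + (s / \<delta>) *\<^sub>R (?y + \<delta> *\<^sub>R w) \<in> C"
      using mid push s \<delta> C(1) by (intro convexD) auto
    moreover have "(1 - s / \<delta>) *\<^sub>R y + (s / \<delta>) *\<^sub>R (y + \<delta> *\<^sub>R w) = y + s *\<^sub>R w" for y
      using \<delta> by (simp add: algebra_simps)
    ultimately show ?thesis by simp
  qed
  with \<delta> show ?thesis by blast
qed

text \<open>
  The face is the one on which \<open>f\<close> equals 1, and the interior point is \<open>x + (t / 2) v\<close>. For \<open>w\<close> in the
  kernel of \<open>f\<close>, the direction \<open>v + \<sigma> w\<close> violates no constraint from \<open>E\<close> once \<open>\<sigma>\<close> is small, because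
  all the constraints other than \<open>f\<close> are strict at \<open>v\<close>.
\<close>

lemma covered_by_algebraic_true_face:
  fixes x :: "'a::real_normed_vector"
  assumes K: "K_polyhedral TYPE('a)" and D: "property_Delta TYPE('a)" and x: "norm x = 1"
  shows "\<exists>F. algebraic_true_face (cball 0 1) F \<and> x \<in> F"
proof -
  obtain E f v where E: "finite E" "f \<in> E" "E \<subseteq> norming_functionals x"
    and fv: "blinfun_apply f v = 0" and gv: "\<And>g. g \<in> E - {f} \<Longrightarrow> blinfun_apply g v < 0"
    and step: "\<And>u. (\<And>g. g \<in> E \<Longrightarrow> blinfun_apply g u \<le> 0) \<Longrightarrow> \<exists>t>0. norm (x + t *\<^sub>R u) \<le> 1"
    using peak_functional[OF assms] by metis
  have f: "f \<in> norming_functionals x" "blinfun_apply f x = 1"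
    using E by (auto simp: norming_functionals_def)
  have "blinfun_apply g v \<le> 0" if "g \<in> E" for g
    using fv gv[of g] that by (cases "g = f") auto
  then obtain t where t: "t > 0" "norm (x + t *\<^sub>R v) \<le> 1"
    using step by blast
  let ?H = "{y. blinfun_apply f y = 1}"
  let ?y = "x + (t / 2) *\<^sub>R v"
  have push: "\<exists>\<delta>>0. \<forall>s. 0 \<le> s \<and> s \<le> \<delta> \<longrightarrow> ?y + s *\<^sub>R w \<in> cball 0 1" if w: "blinfun_apply f w = 0" for w
  proof -
    have "\<forall>\<^sub>F s in at_right 0. \<forall>g\<in>E. blinfun_apply g (v + s *\<^sub>R w) \<le> 0"
    proof (rule eventually_ball_finite[OF E(1)], rule ballI)
      fix g assume g: "g \<in> E"
      show "\<forall>\<^sub>F s in at_right 0. blinfun_apply g (v + s *\<^sub>R w) \<le> 0"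
      proof (cases "g = f")
        case True
        then show ?thesis by (simp add: blinfun.bilinear_simps fv w)
      next
        case False
        have "((\<lambda>s. blinfun_apply g (v + s *\<^sub>R w)) \<longlongrightarrow> blinfun_apply g (v + 0 *\<^sub>R w)) (at_right 0)"
          by (intro tendsto_intros)
        then have "\<forall>\<^sub>F s in at_right 0. blinfun_apply g (v + s *\<^sub>R w) < 0"
          using gv[of g] g False by (intro order_tendstoD(2)[where y = "blinfun_apply g v"]) auto
        then show ?thesis by eventually_elim simp
      qed
    qed
    then have "\<forall>\<^sub>F s in at_right 0. s > 0 \<and> (\<forall>g\<in>E. blinfun_apply g (v + s *\<^sub>R w) \<le> 0)"
      using eventually_at_right_less[of 0] by eventually_elim simp
    then obtain \<sigma> where \<sigma>: "\<sigma> > 0" "\<And>g. g \<in> E \<Longrightarrow> blinfun_apply g (v + \<sigma> *\<^sub>R w) \<le> 0"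
      using eventually_happens'[OF trivial_limit_at_right_real] by blast
    obtain \<tau> where \<tau>: "\<tau> > 0" "norm (x + \<tau> *\<^sub>R (v + \<sigma> *\<^sub>R w)) \<le> 1"
      using step[OF \<sigma>(2)] by blast
    show ?thesis
      using x t \<sigma>(1) \<tau> by (intro convex_midpoint_push[of _ _ _ _ \<tau> \<sigma>]) auto
  qed
  have "?y \<in> algebraic_interior_in ?H (cball 0 1 \<inter> ?H)"
    unfolding algebraic_interior_in_def mem_Collect_eq
  proof (intro conjI ballI)
    have "?y \<in> cball 0 1"
      using push[of 0] by auto
    moreover have fy: "blinfun_apply f ?y = 1"
      by (simp add: blinfun.bilinear_simps f fv)
    ultimately show "?y \<in> cball 0 1 \<inter> ?H" by simp
    fix q assume "q \<in> ?H"
    then have w: "blinfun_apply f (q - ?y) = 0" "blinfun_apply f (- (q - ?y)) = 0"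
      using fy by (simp_all add: blinfun.diff_right blinfun.minus_right)
    obtain d1 where d1: "d1 > 0" "\<And>s. 0 \<le> s \<Longrightarrow> s \<le> d1 \<Longrightarrow> ?y + s *\<^sub>R (q - ?y) \<in> cball 0 1"
      using push[OF w(1)] by blast
    obtain d2 where d2: "d2 > 0" "\<And>s. 0 \<le> s \<Longrightarrow> s \<le> d2 \<Longrightarrow> ?y + s *\<^sub>R (- (q - ?y)) \<in> cball 0 1"
      using push[OF w(2)] by blast
    have "?y + s *\<^sub>R (q - ?y) \<in> cball 0 1 \<inter> ?H" if s: "\<bar>s\<bar> \<le> min d1 d2" for s
    proof
      show "?y + s *\<^sub>R (q - ?y) \<in> cball 0 1"
      proof (cases "s \<ge> 0")
        case True
        then show ?thesis using s by (intro d1) auto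
      next
        case False
        then have "?y + (- s) *\<^sub>R (- (q - ?y)) \<in> cball 0 1"
          using s by (intro d2) auto
        then show ?thesis by (simp only: scaleR_minus_left scaleR_minus_right minus_minus)
      qed
      have "blinfun_apply f (?y + s *\<^sub>R (q - ?y)) = blinfun_apply f ?y + s * blinfun_apply f (q - ?y)"
        by (simp only: blinfun.add_right blinfun.scaleR_right real_scaleR_def)
      then show "?y + s *\<^sub>R (q - ?y) \<in> ?H"
        using fy w(1) by simp
    qed
    then show "\<exists>\<delta>>0. \<forall>s. \<bar>s\<bar> \<le> \<delta> \<longrightarrow> ?y + s *\<^sub>R (q - ?y) \<in> cball 0 1 \<inter> ?H"
      using d1(1) d2(1) by (intro exI[of _ "min d1 d2"]) auto
  qed
  then have "algebraic_true_face (cball 0 1) (cball 0 1 \<inter> ?H)"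
    unfolding algebraic_true_face_def
    using convex_body_cball supporting_hyperplane_norming_functional[OF x f(1)] by blast
  moreover have "x \<in> cball 0 1 \<inter> ?H"
    using x f by simp
  ultimately show ?thesis by blast
qed

text \<open>
  If \<open>z\<close> had norm greater than 1, every point of the segment from \<open>x\<close> to \<open>z\<close> other than \<open>x\<close> would be
  a multiple, by a factor \<open>m > 1\<close>, of a point between \<open>x\<close> and the normalised \<open>z\<close>. The latter has norm
  1, so that the segment would meet the ball only in \<open>x\<close>. For \<open>\<tau> \<ge> 1\<close> convexity suffices, as \<open>z\<close> is then
  between \<open>x\<close> and \<open>x + \<tau> (z - x)\<close>.
\<close>

lemma norm_le_1_of_segment_in_sphere:
  fixes x z :: "'a::real_normed_vector"
  assumes seg: "closed_segment x (z /\<^sub>R norm z) \<subseteq> sphere 0 1"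
    and \<tau>: "\<tau> > 0" "norm (x + \<tau> *\<^sub>R (z - x)) \<le> 1"
  shows "norm z \<le> 1"
proof (rule ccontr)
  assume "\<not> norm z \<le> 1"
  then have c: "norm z > 1" by simp
  then have "z \<noteq> 0" by auto
  have x: "norm x = 1"
    using seg by auto
  show False
  proof (cases "\<tau> \<ge> 1")
    case True
    have "(1 - 1 / \<tau>) *\<^sub>R x + (1 / \<tau>) *\<^sub>R (x + \<tau> *\<^sub>R (z - x)) \<in> cball 0 1"
      using True \<tau> x by (intro convexD[OF convex_cball]) auto
    moreover have "(1 - 1 / \<tau>) *\<^sub>R x + (1 / \<tau>) *\<^sub>R (x + \<tau> *\<^sub>R (z - x)) = z"
      using \<tau>(1) by (simp add: algebra_simps)
    ultimately show False using c by simp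
  next
    case False
    define m where "m = (1 - \<tau>) + \<tau> * norm z"
    have m: "m > 1"
      using c mult_strict_left_mono[OF c \<tau>(1)] by (simp add: m_def)
    let ?y = "(1 - \<tau> * norm z / m) *\<^sub>R x + (\<tau> * norm z / m) *\<^sub>R (z /\<^sub>R norm z)"
    have "?y \<in> closed_segment x (z /\<^sub>R norm z)"
      unfolding in_segment
    proof (intro exI conjI)
      show "0 \<le> \<tau> * norm z / m"
        using m \<tau>(1) by simp
      show "\<tau> * norm z / m \<le> 1"
        using m False by (simp add: m_def)
    qed simp
    then have y: "norm ?y = 1"
      using seg by auto
    have "m *\<^sub>R ?y = (m - \<tau> * norm z) *\<^sub>R x + \<tau> *\<^sub>R z"
    proof -
      have "m * (1 - \<tau> * norm z / m) = m - \<tau> * norm z"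
        using m by (simp add: field_simps)
      moreover have "m * (\<tau> * norm z / m) * inverse (norm z) = \<tau>"
        using m \<open>z \<noteq> 0\<close> by (simp add: field_simps)
      ultimately show ?thesis
        by (simp only: scaleR_add_right scaleR_scaleR mult.assoc[symmetric])
    qed
    also have "\<dots> = x + \<tau> *\<^sub>R (z - x)"
      by (simp add: m_def algebra_simps)
    finally have "norm (x + \<tau> *\<^sub>R (z - x)) = m"
      using y m by (metis norm_scaleR mult.right_neutral abs_of_pos less_trans zero_less_one)
    then show False using \<tau>(2) m by simp
  qed
qed

lemma dist_normalised_le:
  fixes x z :: "'a::real_normed_vector"
  assumes "norm x = 1" "z \<noteq> 0"
  shows "dist x (z /\<^sub>R norm z) \<le> 2 * norm (z - x)"
proof -
  have "z /\<^sub>R norm z - z = (inverse (norm z) - 1) *\<^sub>R z"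
    by (simp add: algebra_simps)
  then have "norm (z /\<^sub>R norm z - z) = \<bar>inverse (norm z) - 1\<bar> * \<bar>norm z\<bar>"
    by simp
  also have "\<dots> = \<bar>(inverse (norm z) - 1) * norm z\<bar>"
    by (rule abs_mult[symmetric])
  also have "\<dots> = \<bar>norm z - norm x\<bar>"
    using assms by (simp add: left_diff_distrib abs_minus_commute)
  also have "\<dots> \<le> norm (z - x)"
    by (rule norm_triangle_ineq3)
  finally show ?thesis
    using norm_triangle_ineq[of "z /\<^sub>R norm z - z" "z - x"]
    by (simp add: dist_norm norm_minus_commute[of x])
qed

text \<open>
  For \<open>z\<close> near \<open>x + t v\<close> with \<open>f z = 1\<close>, no constraint from \<open>E\<close> is violated by the direction \<open>z - x\<close>, so
  some initial part of the segment from \<open>x\<close> to \<open>z\<close> is in the ball; since \<open>z\<close> is close to \<open>x\<close>, property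
  (VI) then puts \<open>z\<close> itself in the ball. The radius \<open>\<epsilon>\<close> works for all \<open>z\<close> at once, as the functionals in
  \<open>E\<close> have norm 1.
\<close>

lemma covered_by_true_face:
  fixes x :: "'a::real_normed_vector"
  assumes K: "K_polyhedral TYPE('a)" and D: "property_Delta TYPE('a)" and VI: "VI_polyhedral TYPE('a)"
    and x: "norm x = 1"
  shows "\<exists>F. true_face (cball 0 1) F \<and> x \<in> F"
proof -
  obtain E f v where E: "finite E" "f \<in> E" "E \<subseteq> norming_functionals x"
    and fv: "blinfun_apply f v = 0" and gv: "\<And>g. g \<in> E - {f} \<Longrightarrow> blinfun_apply g v < 0"
    and step: "\<And>u. (\<And>g. g \<in> E \<Longrightarrow> blinfun_apply g u \<le> 0) \<Longrightarrow> \<exists>t>0. norm (x + t *\<^sub>R u) \<le> 1"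
    using peak_functional[OF K D x] by metis
  have f: "f \<in> norming_functionals x" "blinfun_apply f x = 1"
    using E by (auto simp: norming_functionals_def)
  have E1: "norm g = 1" if "g \<in> E" for g
    using E that by (auto simp: norming_functionals_def)
  obtain V where V: "open V" "x \<in> V" "\<And>y. y \<in> V \<Longrightarrow> norm y = 1 \<Longrightarrow> closed_segment x y \<subseteq> sphere 0 1"
  proof -
    have "\<exists>V. open V \<and> x \<in> V \<and> (\<forall>y \<in> V \<inter> sphere 0 1. closed_segment x y \<subseteq> sphere 0 1)"
      by (rule VI[unfolded VI_polyhedral_def, rule_format]) (simp add: x)
    then obtain V where V: "open V" "x \<in> V" "\<forall>y \<in> V \<inter> sphere 0 1. closed_segment x y \<subseteq> sphere 0 1"
      by blast
    have "closed_segment x y \<subseteq> sphere 0 1" if "y \<in> V" "norm y = 1" for y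
      using V(3)[rule_format, of y] that by simp
    with V(1,2) show ?thesis by (rule that)
  qed
  obtain r where r: "r > 0" "\<And>y. dist x y < r \<Longrightarrow> y \<in> V"
    using V(1,2) unfolding open_dist by (metis dist_commute)
  \<comment> \<open>Normalising \<open>z\<close> at most doubles its distance from \<open>x\<close>, so \<open>z\<close> has to be within \<open>r / 2\<close> of \<open>x\<close>. The
    steps \<open>t v\<close> and \<open>w\<close> take up one half of this each; adding 1 covers the case \<open>v = 0\<close>.\<close>
  define t where "t = r / (4 * (norm v + 1))"
  have t: "t > 0" "t * norm v < r / 4"
    using r(1) by (auto simp: t_def field_simps add_pos_nonneg intro: add_nonneg_pos)
  define \<epsilon> where "\<epsilon> = Min (insert (r / 4) ((\<lambda>g. - t * blinfun_apply g v) ` (E - {f})))"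
  have \<epsilon>: "\<epsilon> > 0" "\<epsilon> \<le> r / 4" "\<And>g. g \<in> E - {f} \<Longrightarrow> \<epsilon> \<le> - t * blinfun_apply g v"
  proof -
    show "\<epsilon> > 0"
      unfolding \<epsilon>_def using E(1) r(1) t(1) gv by (auto simp: mult_pos_neg)
    show "\<epsilon> \<le> r / 4"
      unfolding \<epsilon>_def by (rule Min_le) (use E(1) in auto)
    show "\<epsilon> \<le> - t * blinfun_apply g v" if "g \<in> E - {f}" for g
      unfolding \<epsilon>_def by (rule Min_le) (use E(1) that in auto)
  qed
  let ?H = "{y. blinfun_apply f y = 1}"
  let ?y = "x + t *\<^sub>R v"
  have near: "z \<in> cball 0 1" if z: "dist ?y z < \<epsilon>" "blinfun_apply f z = 1" for z
  proof -
    define w where "w = z - ?y"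
    have w: "norm w < \<epsilon>" "z - x = t *\<^sub>R v + w" "blinfun_apply f w = 0"
      using z f by (auto simp: w_def dist_norm norm_minus_commute blinfun.bilinear_simps fv)
    have "blinfun_apply g (z - x) \<le> 0" if g: "g \<in> E" for g
    proof (cases "g = f")
      case True
      then show ?thesis using z(2) f by (simp add: blinfun.diff_right)
    next
      case False
      have "blinfun_apply g w \<le> norm w"
        using norm_blinfun[of g w] E1[OF g] by simp
      then show ?thesis
        using \<epsilon>(3)[of g] g False w(1) by (simp add: w(2) blinfun.bilinear_simps)
    qed
    then obtain \<tau> where \<tau>: "\<tau> > 0" "norm (x + \<tau> *\<^sub>R (z - x)) \<le> 1"
      using step by blast
    have z0: "z \<noteq> 0"
      using z(2) by auto
    have "norm (z - x) \<le> norm (t *\<^sub>R v) + norm w"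
      unfolding w(2) by (rule norm_triangle_ineq)
    then have "norm (z - x) < r / 2"
      using t w(1) \<epsilon>(2) by simp
    then have "dist x (z /\<^sub>R norm z) < r"
      using dist_normalised_le[OF x z0] by simp
    then have "closed_segment x (z /\<^sub>R norm z) \<subseteq> sphere 0 1"
      using z0 by (intro V r) auto
    then show ?thesis
      using norm_le_1_of_segment_in_sphere \<tau> by auto
  qed
  have "?y \<in> top_of_set ?H interior_of (cball 0 1 \<inter> ?H)"
    unfolding interior_of_def mem_Collect_eq
  proof (intro exI conjI)
    show "openin (top_of_set ?H) (?H \<inter> ball ?y \<epsilon>)"
      by (intro openin_open_Int open_ball)
    show "?y \<in> ?H \<inter> ball ?y \<epsilon>"
      using \<epsilon>(1) by (simp add: blinfun.bilinear_simps f fv)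
    show "?H \<inter> ball ?y \<epsilon> \<subseteq> cball 0 1 \<inter> ?H"
      using near by auto
  qed
  then have "true_face (cball 0 1) (cball 0 1 \<inter> ?H)"
    unfolding true_face_def
    using convex_body_cball supporting_hyperplane_norming_functional[OF x f(1)] by blast
  moreover have "x \<in> cball 0 1 \<inter> ?H"
    using x f by simp
  ultimately show ?thesis by blast
qed

theorem theorem1:
  assumes "K_polyhedral TYPE('a::real_normed_vector)"
    and "property_Delta TYPE('a)"
  shows "(\<forall>x\<in>sphere (0::'a) 1. \<exists>F. algebraic_true_face (cball 0 1) F \<and> x \<in> F) \<and>
    (VI_polyhedral TYPE('a) \<longrightarrow>
      (\<forall>x\<in>sphere (0::'a) 1. \<exists>F. true_face (cball 0 1) F \<and> x \<in> F))"
  using covered_by_algebraic_true_face[OF assms] covered_by_true_face[OF assms] by auto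

end
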